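(* Let $q\ge 2$, $d\ge1$ be integers and $\alpha\in[0,1)$. On the infinite $(q+1)$-regular tree $\mathbb{T}_{q+1}$, let $X,Y$ be vertices with $\operatorname{dist}(X,Y)=d$, and let $\mathfrak{m}_X^n,\mathfrak{m}_Y^n$ be the distributions after $n$ steps of the simple random walk with laziness $\alpha$ started at $X$, respectively $Y$. Put $\delta=\lfloor d/2\rfloor$, $\delta'=\lceil d/2\rceil$. Then, as $n\to\infty$, \[ W_1(\mathfrak{m}_X^n, \mathfrak{m}_Y^n) = A^{\mathrm{SRW}}_{\alpha, d, q} \cdot n + B^{\mathrm{SRW}}_{\alpha, d, q} + o(1), \] where \[ A^{\mathrm{SRW}}_{\alpha, d, q} = 2(1-\alpha)(q+1 - q^{1-\delta'} - q^{-\delta}) \cdot \frac{q-1}{(q+1)^2},\qquad B^{\mathrm{SRW}}_{\alpha, d, q} = d + \frac{2(\delta q^{-\delta} + \delta' q^{1-\delta'})}{q+1} + \frac{2(q^{1-\delta} - q^{1-\delta'})}{(q+1)^2}. \]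
   Context: The simple random walk with laziness $\alpha$ from $u$: $p_0=u$, and at each step $p_{i+1}=p_i$ with probability $\alpha$ and $p_{i+1}=w$ with probability $\frac{1-\alpha}{q+1}$ for each neighbor $w$ of $p_i$; $\mathfrak{m}_u^n(v)=\mathbb{P}(p_n=v)$. $W_1$ is the $1$-Wasserstein distance with respect to graph distance: the minimum over couplings $\pi$ of $\mu,\nu$ of $\sum_{v,w}\operatorname{dist}(v,w)\pi(v,w)$. *)

theory Defs
  imports "HOL-Probability.Probability" "HOL-Library.Landau_Symbols"
begin

section \<open>Regular trees\<close>

text \<open>A graph is given by its adjacency relation; the vertex set is the whole type.\<close>

definition neighbors :: "('v \<Rightarrow> 'v \<Rightarrow> bool) \<Rightarrow> 'v \<Rightarrow> 'v set" where
  "neighbors E u = {w. E u w}"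

definition simple_graph :: "('v \<Rightarrow> 'v \<Rightarrow> bool) \<Rightarrow> bool" where
  "simple_graph E \<longleftrightarrow> symp E \<and> irreflp E"

definition connected_graph :: "('v \<Rightarrow> 'v \<Rightarrow> bool) \<Rightarrow> bool" where
  "connected_graph E \<longleftrightarrow> (\<forall>u v. E\<^sup>*\<^sup>* u v)"

definition is_cycle :: "('v \<Rightarrow> 'v \<Rightarrow> bool) \<Rightarrow> 'v list \<Rightarrow> bool" where
  "is_cycle E vs \<longleftrightarrow> length vs \<ge> 3 \<and> distinct vs \<and> successively E (vs @ [hd vs])"

definition is_tree :: "('v \<Rightarrow> 'v \<Rightarrow> bool) \<Rightarrow> bool" where
  "is_tree E \<longleftrightarrow> simple_graph E \<and> connected_graph E \<and> (\<nexists>vs. is_cycle E vs)"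

definition regular_graph :: "nat \<Rightarrow> ('v \<Rightarrow> 'v \<Rightarrow> bool) \<Rightarrow> bool" where
  "regular_graph k E \<longleftrightarrow> (\<forall>u. finite (neighbors E u) \<and> card (neighbors E u) = k)"

text \<open>Two vertices are related by the \<open>k\<close>-fold relational power of \<open>E\<close> iff they are
  joined by a walk with \<open>k\<close> edges. The value is meaningful for connected graphs only.\<close>

definition graph_dist :: "('v \<Rightarrow> 'v \<Rightarrow> bool) \<Rightarrow> 'v \<Rightarrow> 'v \<Rightarrow> nat" where
  "graph_dist E u v = (LEAST k. (E ^^ k) u v)"

section \<open>Lazy simple random walk\<close>

definition lazy_step :: "('v \<Rightarrow> 'v \<Rightarrow> bool) \<Rightarrow> real \<Rightarrow> 'v \<Rightarrow> 'v pmf" where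
  "lazy_step E \<alpha> u =
     bernoulli_pmf \<alpha> \<bind> (\<lambda>stay. if stay then return_pmf u else pmf_of_set (neighbors E u))"

primrec lazy_walk :: "('v \<Rightarrow> 'v \<Rightarrow> bool) \<Rightarrow> real \<Rightarrow> 'v \<Rightarrow> nat \<Rightarrow> 'v pmf" where
  "lazy_walk E \<alpha> u 0 = return_pmf u"
| "lazy_walk E \<alpha> u (Suc n) = lazy_walk E \<alpha> u n \<bind> lazy_step E \<alpha>"

lemma pmf_lazy_step:
  assumes "simple_graph E" "regular_graph (q + 1) E" "0 \<le> \<alpha>" "\<alpha> \<le> 1"
  shows "pmf (lazy_step E \<alpha> u) w =
           (if w = u then \<alpha> else if w \<in> neighbors E u then (1 - \<alpha>) / (real q + 1) else 0)"
proof -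
  have fin: "finite (neighbors E u)" and c: "card (neighbors E u) = q + 1"
    using assms(2) by (auto simp: regular_graph_def)
  have ne: "neighbors E u \<noteq> {}"
    using c by auto
  have "u \<notin> neighbors E u"
    using assms(1) by (auto simp: simple_graph_def neighbors_def irreflp_def)
  then show ?thesis
    using assms(3,4) fin ne c
    by (auto simp: lazy_step_def pmf_bind pmf_of_set indicator_def add.commute)
qed

section \<open>The 1-Wasserstein distance\<close>

definition couplings :: "'v pmf \<Rightarrow> 'v pmf \<Rightarrow> ('v \<times> 'v) pmf set" where
  "couplings \<mu> \<nu> = {\<pi>. map_pmf fst \<pi> = \<mu> \<and> map_pmf snd \<pi> = \<nu>}"

definition transport_cost :: "('v \<Rightarrow> 'v \<Rightarrow> bool) \<Rightarrow> ('v \<times> 'v) pmf \<Rightarrow> ennreal" where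
  "transport_cost E \<pi> = (\<integral>\<^sup>+ (v, w). ennreal (real (graph_dist E v w)) \<partial>measure_pmf \<pi>)"

text \<open>The infimum is the minimum whenever the latter exists, in particular for finitely
  supported \<open>\<mu>\<close>, \<open>\<nu>\<close>. Beware that \<open>enn2real\<close> sends an infinite cost to 0;
  this does not occur for finitely supported \<open>\<mu>\<close>, \<open>\<nu>\<close>.\<close>

definition wasserstein1 :: "('v \<Rightarrow> 'v \<Rightarrow> bool) \<Rightarrow> 'v pmf \<Rightarrow> 'v pmf \<Rightarrow> real" where
  "wasserstein1 E \<mu> \<nu> = enn2real (INF \<pi> \<in> couplings \<mu> \<nu>. transport_cost E \<pi>)"

lemma wasserstein1_eq_min:
  assumes "\<pi> \<in> couplings \<mu> \<nu>"
    and "\<And>\<pi>'. \<pi>' \<in> couplings \<mu> \<nu> \<Longrightarrow> transport_cost E \<pi> \<le> transport_cost E \<pi>'"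
  shows "wasserstein1 E \<mu> \<nu> = enn2real (transport_cost E \<pi>)"
proof -
  have "(INF \<pi> \<in> couplings \<mu> \<nu>. transport_cost E \<pi>) = transport_cost E \<pi>"
    using assms by (intro antisym INF_lower INF_greatest)
  then show ?thesis
    by (simp add: wasserstein1_def)
qed

section \<open>The coefficients of the asymptotic expansion\<close>

definition A_SRW :: "real \<Rightarrow> nat \<Rightarrow> nat \<Rightarrow> real" where
  "A_SRW \<alpha> d q =
    (let \<delta> = \<lfloor>real d / 2\<rfloor>; \<delta>' = \<lceil>real d / 2\<rceil>; Q = real q in
     2 * (1 - \<alpha>) * (Q + 1 - Q powi (1 - \<delta>') - Q powi (- \<delta>)) * ((Q - 1) / (Q + 1)\<^sup>2))"

definition B_SRW :: "real \<Rightarrow> nat \<Rightarrow> nat \<Rightarrow> real" where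
  "B_SRW \<alpha> d q =
    (let \<delta> = \<lfloor>real d / 2\<rfloor>; \<delta>' = \<lceil>real d / 2\<rceil>; Q = real q in
     real d
     + 2 * (of_int \<delta> * Q powi (- \<delta>) + of_int \<delta>' * Q powi (1 - \<delta>')) / (Q + 1)
     + 2 * (Q powi (1 - \<delta>) - Q powi (1 - \<delta>')) / (Q + 1)\<^sup>2)"

end

theory Submission
  imports Defs "HOL-Library.Transitive_Closure_Table"
begin

text \<open>
  Let \<open>a\<close> and \<open>b\<close> be the distances of a vertex to \<open>X\<close> and \<open>Y\<close>. The function \<open>f\<close> equal to
  \<open>b - d/2\<close> where \<open>a < b\<close>, to \<open>d/2 - a\<close> where \<open>b < a\<close>, and to \<open>0\<close> where \<open>a = b\<close> is
  1-Lipschitz by the four-point condition, and \<open>dist v w = f v - f w\<close> whenever \<open>v\<close> is closer to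
  \<open>X\<close> and \<open>w\<close> is closer to \<open>Y\<close>. By complementary slackness \<open>W\<^sub>1\<close> is the difference of the
  expectations of \<open>f\<close> as soon as some local transport exhausts the mass of the walk from \<open>Y\<close>
  near \<open>X\<close> and that of the walk from \<open>X\<close> near \<open>Y\<close>; the rest may be coupled arbitrarily. The
  probability of a vertex decreases along steps of length two in its distance from the start, so
  the mass can be cancelled in place if \<open>d\<close> is even, and by moving it along single edges if \<open>d\<close>
  is odd.

  The expectations are computed with a martingale. The Laplacian maps \<open>f\<close> to a multiple of
  the sign of \<open>f\<close>; adding to \<open>f\<close> a correction of the form \<open>(C r - C') q\<^sup>-\<^sup>r\<close> replaces the sign by a
  harmonic function. The correction has vanishing expectation since the expectation of
  \<open>q\<^sup>-\<^sup>a\<^sup>/\<^sup>2\<close> decays geometrically.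
\<close>

section \<open>Distances in graphs and trees\<close>

locale undirected_graph =
  fixes E :: "'v \<Rightarrow> 'v \<Rightarrow> bool"
  assumes simple: "simple_graph E"
begin

lemma adj_sym: "E u v \<Longrightarrow> E v u"
  using simple by (auto simp: simple_graph_def symp_def)

lemma adj_irrefl: "\<not> E u u"
  using simple by (auto simp: simple_graph_def irreflp_def)

lemma relpowp_adj_sym: "(E ^^ k) u v \<Longrightarrow> (E ^^ k) v u"
proof (induction k arbitrary: v)
  case (Suc k)
  then show ?case
    by (metis adj_sym relpowp_Suc_E relpowp_Suc_I2)
qed auto

lemma in_neighbors [simp]: "w \<in> neighbors E v \<longleftrightarrow> E v w"
  by (simp add: neighbors_def)

end

locale connected_undirected_graph = undirected_graph E for E :: "'v \<Rightarrow> 'v \<Rightarrow> bool" +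
  assumes connected: "connected_graph E"
begin

abbreviation D :: "'v \<Rightarrow> 'v \<Rightarrow> nat" where "D \<equiv> graph_dist E"

lemma relpowp_dist: "(E ^^ D u v) u v"
proof -
  have "\<exists>k. (E ^^ k) u v"
    using connected rtranclp_imp_relpowp[of E u v] by (auto simp: connected_graph_def)
  then show ?thesis
    unfolding graph_dist_def by (rule LeastI_ex)
qed

lemma dist_le_if_relpowp: "(E ^^ k) u v \<Longrightarrow> D u v \<le> k"
  unfolding graph_dist_def by (rule Least_le)

lemma dist_self [simp]: "D u u = 0"
  using dist_le_if_relpowp[of 0 u u] by simp

lemma dist_eq_0_iff [simp]: "D u v = 0 \<longleftrightarrow> u = v"
  using relpowp_dist[of u v] by auto

lemma dist_commute: "D u v = D v u"
  using dist_le_if_relpowp[OF relpowp_adj_sym[OF relpowp_dist]] by (metis le_antisym)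

lemma dist_triangle: "D u w \<le> D u v + D v w"
  by (rule dist_le_if_relpowp, rule relpowp_trans, rule relpowp_dist, rule relpowp_dist)

lemma dist_adj: "E u v \<Longrightarrow> D u v = 1"
  using dist_le_if_relpowp[of 1 u v] dist_eq_0_iff[of u v] adj_irrefl[of u]
  by (cases "D u v") (auto simp del: dist_eq_0_iff)

lemma dist_adj_le: "E v w \<Longrightarrow> D w u \<le> D v u + 1"
  using dist_triangle[of w u v] dist_adj[of w v] adj_sym by fastforce

lemma ex_closer_neighbor:
  assumes "v \<noteq> u"
  obtains w where "E v w" "D v u = D w u + 1"
proof -
  obtain k where k: "D v u = Suc k"
    using assms by (cases "D v u") auto
  with relpowp_dist[of v u] obtain w where w: "E v w" "(E ^^ k) w u"
    by (metis relpowp_Suc_D2)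
  have "D w u \<le> k" using dist_le_if_relpowp w by blast
  moreover have "D v u \<le> D w u + 1" using dist_adj_le w(1) adj_sym by blast
  ultimately show ?thesis using that w k by force
qed

definition adj_avoiding :: "'v \<Rightarrow> 'v \<Rightarrow> 'v \<Rightarrow> bool" where
  "adj_avoiding v x y \<longleftrightarrow> E x y \<and> x \<noteq> v \<and> y \<noteq> v"

lemma rtranclp_adj_avoiding_sym: "(adj_avoiding v)\<^sup>*\<^sup>* x y \<Longrightarrow> (adj_avoiding v)\<^sup>*\<^sup>* y x"
  using symp_rtranclp[of "adj_avoiding v"] adj_sym by (auto simp: symp_def adj_avoiding_def)

lemma path_adj_avoiding:
  assumes "rtrancl_path (adj_avoiding v) x xs y"
  shows "successively E (x # xs) \<and> last (x # xs) = y \<and> v \<notin> set xs"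
  using assms by induction (auto simp: adj_avoiding_def)

lemma geodesic_avoids_farther_vertex:
  assumes "w \<noteq> v" "D w u \<le> D v u"
  shows "(adj_avoiding v)\<^sup>*\<^sup>* w u"
  using assms
proof (induction "D w u" arbitrary: w)
  case (Suc k)
  then have "w \<noteq> u" by auto
  then obtain x where x: "E w x" "D w u = D x u + 1"
    using ex_closer_neighbor by blast
  then have "x \<noteq> v" using Suc by auto
  then have "(adj_avoiding v)\<^sup>*\<^sup>* x u"
    using Suc x by auto
  moreover have "adj_avoiding v w x"
    using x(1) Suc.prems(1) \<open>x \<noteq> v\<close> by (simp add: adj_avoiding_def)
  ultimately show ?case by (rule converse_rtranclp_into_rtranclp[rotated])
qed auto

end

locale tree_graph = connected_undirected_graph E for E :: "'v \<Rightarrow> 'v \<Rightarrow> bool" +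
  assumes acyclic: "\<not> is_cycle E vs"
begin

lemma neighbors_eq_if_connected_avoiding:
  assumes adj: "E v w" "E v w'" and path: "(adj_avoiding v)\<^sup>*\<^sup>* w w'"
  shows "w = w'"
proof (rule ccontr)
  assume "w \<noteq> w'"
  obtain xs where xs: "rtrancl_path (adj_avoiding v) w xs w'" "distinct (w # xs)"
    using path rtrancl_path_distinct by (metis rtranclp_eq_rtrancl_path)
  from path_adj_avoiding[OF xs(1)]
  have walk: "successively E (w # xs)" "last (w # xs) = w'" and "v \<notin> set xs"
    by auto
  have "successively E ((v # w # xs) @ [hd (v # w # xs)])"
    using walk adj adj_sym[of v w'] by (simp add: successively_append_iff del: append_Cons)
  moreover have "distinct (v # w # xs)" "length (v # w # xs) \<ge> 3"
    using xs(2) \<open>v \<notin> set xs\<close> adj(1) adj_irrefl walk(2) \<open>w \<noteq> w'\<close> by (auto simp: Suc_le_eq)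
  ultimately have "is_cycle E (v # w # xs)"
    unfolding is_cycle_def by blast
  with acyclic show False ..
qed

lemma closer_neighbor_unique:
  assumes "E v w" "E v w'" "D w u \<le> D v u" "D w' u \<le> D v u"
  shows "w = w'"
proof (rule neighbors_eq_if_connected_avoiding[OF assms(1,2)])
  have "w \<noteq> v" "w' \<noteq> v" using assms(1,2) adj_irrefl by auto
  then have "(adj_avoiding v)\<^sup>*\<^sup>* w u" "(adj_avoiding v)\<^sup>*\<^sup>* u w'"
    using geodesic_avoids_farther_vertex assms(3,4) rtranclp_adj_avoiding_sym by blast+
  then show "(adj_avoiding v)\<^sup>*\<^sup>* w w'"
    by (rule rtranclp_trans)
qed

lemma dist_neighbor_cases:
  assumes "E v w"
  obtains (farther) "D w u = D v u + 1" | (closer) "D v u = D w u + 1"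
proof (cases "D w u \<le> D v u")
  case True
  then have "v \<noteq> u"
    using assms adj_irrefl by fastforce
  then obtain w' where w': "E v w'" "D v u = D w' u + 1"
    using ex_closer_neighbor by blast
  have "w = w'"
    using closer_neighbor_unique[OF assms w'(1), of u] True w'(2) by simp
  then show ?thesis using w' closer by simp
next
  case False
  then show ?thesis using dist_adj_le[OF assms, of u] farther by simp
qed

text \<open>The tree is regarded as rooted at \<open>u\<close>; \<open>parent u u\<close> is a junk value.\<close>

definition parent :: "'v \<Rightarrow> 'v \<Rightarrow> 'v" where
  "parent u v = (THE w. E v w \<and> D v u = D w u + 1)"

definition children :: "'v \<Rightarrow> 'v \<Rightarrow> 'v set" where
  "children u v = {w. E v w \<and> D w u = D v u + 1}"

lemma parent_eqI: "E v w \<Longrightarrow> D v u = D w u + 1 \<Longrightarrow> parent u v = w"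
  unfolding parent_def using closer_neighbor_unique[of v _ w u] by (intro the_equality) auto

lemma
  assumes "v \<noteq> u"
  shows adj_parent: "E v (parent u v)"
    and dist_parent: "D v u = D (parent u v) u + 1"
  using ex_closer_neighbor[OF assms] parent_eqI by metis+

lemma parent_eq_if_child: "v \<in> children u w \<Longrightarrow> parent u v = w"
  using adj_sym by (intro parent_eqI) (auto simp: children_def)

lemma neighbors_eq_parent_children:
  assumes "v \<noteq> u"
  shows "neighbors E v = insert (parent u v) (children u v)"
proof -
  have "w = parent u v \<or> w \<in> children u v" if "E v w" for w
    using that parent_eqI[OF that, of u]
    by (cases rule: dist_neighbor_cases[OF that, of u]) (auto simp: children_def)
  then have "neighbors E v \<subseteq> insert (parent u v) (children u v)" using in_neighbors by blast
  then show ?thesis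
    using adj_parent[OF assms] by (intro equalityI) (auto simp: children_def)
qed

lemma parent_notin_children: "v \<noteq> u \<Longrightarrow> parent u v \<notin> children u v"
  using dist_parent[of v u] by (auto simp: children_def)

lemma dist_across_edge:
  assumes "v \<in> children w v'" "v' \<in> children y v"
  shows "D w y = D w v + D v y"
  using assms
proof (induction "D v' w" arbitrary: v v')
  case 0
  then show ?case using dist_commute[of w v] by (simp add: children_def)
next
  case (Suc k)
  then have "v' \<noteq> w" by auto
  let ?p = "parent w v'"
  have p: "v' \<in> children w ?p"
    using adj_parent dist_parent \<open>v' \<noteq> w\<close> adj_sym by (simp add: children_def)
  have "v' \<noteq> y" using Suc.prems(2) by (auto simp: children_def)
  then have "?p \<in> insert v (children y v')"
    using neighbors_eq_parent_children[of v' y] parent_eq_if_child[OF Suc.prems(2)]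
      in_neighbors adj_parent[OF \<open>v' \<noteq> w\<close>] by blast
  moreover have "?p \<noteq> v" using p Suc.prems(1) by (auto simp: children_def)
  ultimately have "?p \<in> children y v'" by simp
  then have "D w y = D w v' + D v' y"
    using Suc.hyps(1)[OF _ p] Suc.hyps(2) p by (simp add: children_def)
  then show ?case
    using Suc.prems dist_commute[of w v] dist_commute[of w v'] by (simp add: children_def)
qed

lemma four_point:
  assumes "D v x + D w y < D v y + D w x"
  shows "D v w + D x y = D v y + D w x"
  using assms
proof (induction "D v w" arbitrary: v)
  case (Suc k)
  let ?p = "parent w v"
  have "v \<noteq> w" using Suc.hyps(2) by auto
  then have p: "E v ?p" "D v w = D ?p w + 1" and child: "v \<in> children w ?p"
    using adj_parent dist_parent adj_sym by (auto simp: children_def)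
  have closer_y: "D v y = D ?p y + 1"
  proof (rule dist_neighbor_cases[OF p(1)])
    assume "D ?p y = D v y + 1"
    then have "D w y = D w v + D v y"
      using p(1) by (intro dist_across_edge[OF child]) (simp add: children_def)
    then show ?thesis
      using Suc.prems dist_triangle[of w x v] by simp
  qed
  from p(1) show ?case
  proof (cases rule: dist_neighbor_cases[where u = x])
    case closer
    then show ?thesis using Suc p closer_y by auto
  next
    case farther
    then have "?p \<in> children x v" "v \<in> children y ?p"
      using p(1) closer_y adj_sym by (auto simp: children_def)
    then have "D y x = D y v + D v x" "D w x = D w v + D v x"
      using dist_across_edge child by blast+
    then show ?thesis
      using dist_commute[of x y] dist_commute[of v w] dist_commute[of v y] by simp
  qed
qed simp

lemma even_dist_sum: "even (D v x + D v y + D x y)"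
proof (induction "D v x" arbitrary: v)
  case (Suc k)
  then have "v \<noteq> x" by auto
  then obtain v' where v': "E v v'" "D v x = D v' x + 1"
    using ex_closer_neighbor by blast
  then have "even (D v' x + D v' y + D x y)" using Suc by auto
  with v' show ?case by (cases rule: dist_neighbor_cases[OF v'(1), of y]) auto
qed auto

definition half_tree :: "'v \<Rightarrow> 'v \<Rightarrow> 'v set" where
  "half_tree X Y = {v. D v X < D v Y}"

lemma in_half_tree [simp]: "v \<in> half_tree X Y \<longleftrightarrow> D v X < D v Y"
  by (simp add: half_tree_def)

lemma half_tree_child: "v \<in> half_tree X Y \<Longrightarrow> w \<in> children Y v \<Longrightarrow> w \<in> half_tree X Y"
  using dist_adj_le[of v w X] by (simp add: children_def)

end

section \<open>The signed distance to the midpoint\<close>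

definition midpoint_offset :: "nat \<Rightarrow> nat \<Rightarrow> real" where
  "midpoint_offset d r = real r - real d / 2"

context tree_graph
begin

definition odd_ext :: "'v \<Rightarrow> 'v \<Rightarrow> (nat \<Rightarrow> real) \<Rightarrow> 'v \<Rightarrow> real" where
  "odd_ext X Y \<phi> v =
     (if v \<in> half_tree X Y then \<phi> (D v Y) else if v \<in> half_tree Y X then - \<phi> (D v X) else 0)"

lemma odd_ext_swap: "odd_ext Y X \<phi> v = - odd_ext X Y \<phi> v"
  by (auto simp: odd_ext_def)

abbreviation potential :: "'v \<Rightarrow> 'v \<Rightarrow> 'v \<Rightarrow> real" where
  "potential X Y \<equiv> odd_ext X Y (midpoint_offset (D X Y))"

lemma potential_lipschitz: "potential X Y v - potential X Y w \<le> real (D v w)"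
proof -
  have "D v X + D w Y < D v Y + D w X \<Longrightarrow> D v w + D X Y = D v Y + D w X"
    by (rule four_point)
  moreover have "D X Y \<le> D v X + D v Y" "D X Y \<le> D w X + D w Y"
    using dist_triangle[of X Y v] dist_triangle[of X Y w]
    by (simp_all add: dist_commute[of X v] dist_commute[of X w])
  moreover have "D v Y \<le> D v w + D w Y" "D w X \<le> D v w + D v X"
    using dist_triangle[of v Y w] dist_triangle[of w X v] by (simp_all add: dist_commute[of w v])
  ultimately show ?thesis
    unfolding odd_ext_def midpoint_offset_def
    by (cases "D v X" "D v Y" rule: linorder_cases; cases "D w X" "D w Y" rule: linorder_cases)
      (simp_all; linarith)+
qed

lemma potential_tight:
  assumes "v \<in> half_tree X Y" "w \<in> half_tree Y X"
  shows "real (D v w) = potential X Y v - potential X Y w"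
proof -
  have "D v w + D X Y = D v Y + D w X"
    using assms by (intro four_point) auto
  then show ?thesis
    using assms by (simp add: odd_ext_def midpoint_offset_def field_simps flip: of_nat_add)
qed

end

section \<open>Optimal couplings\<close>

lemma pmf_map_eq_sum:
  assumes "finite A" "set_pmf p \<subseteq> A"
  shows "pmf (map_pmf f p) y = (\<Sum>x | x \<in> A \<and> f x = y. pmf p x)"
proof -
  have "pmf (map_pmf f p) y = measure p {x \<in> A. f x = y}"
    unfolding pmf_map by (rule measure_prob_cong_0) (use assms in \<open>auto simp: set_pmf_iff\<close>)
  then show ?thesis
    using assms(1) by (simp add: measure_measure_pmf_finite)
qed

lemma
  assumes "finite S" "finite T" "set_pmf \<pi> \<subseteq> S \<times> T"
  shows pmf_map_fst_eq_sum: "pmf (map_pmf fst \<pi>) v = (\<Sum>w\<in>T. pmf \<pi> (v, w))"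
    and pmf_map_snd_eq_sum: "pmf (map_pmf snd \<pi>) w = (\<Sum>v\<in>S. pmf \<pi> (v, w))"
proof -
  have "{x \<in> insert v S \<times> T. fst x = v} = {v} \<times> T" by auto
  then show "pmf (map_pmf fst \<pi>) v = (\<Sum>w\<in>T. pmf \<pi> (v, w))"
    using assms by (subst pmf_map_eq_sum[of "insert v S \<times> T"]) (auto simp: sum.cartesian_product')
  have "{x \<in> S \<times> insert w T. snd x = w} = S \<times> {w}" by auto
  then show "pmf (map_pmf snd \<pi>) w = (\<Sum>v\<in>S. pmf \<pi> (v, w))"
    using assms by (subst pmf_map_eq_sum[of "S \<times> insert w T"]) (auto simp: sum.cartesian_product')
qed

lemma pmf_embed_pmf_finite:
  assumes "finite A" "\<And>x. 0 \<le> f x" "\<And>x. x \<notin> A \<Longrightarrow> f x = 0" "sum f A = 1"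
  shows "pmf (embed_pmf f) x = f x"
proof (rule pmf_embed_pmf)
  have "(\<integral>\<^sup>+ x. ennreal (f x) \<partial>count_space UNIV) = (\<Sum>x\<in>A. ennreal (f x))"
    using assms(1,3) by (intro nn_integral_count_space') simp_all
  also have "\<dots> = 1"
    using assms(2,4) by (simp add: sum_ennreal)
  finally show "(\<integral>\<^sup>+ x. ennreal (f x) \<partial>count_space UNIV) = 1" .
qed (rule assms(2))

lemma ex_coupling_with_pmf:
  fixes \<mu> \<nu> :: "'v pmf" and F :: "'v \<Rightarrow> 'v \<Rightarrow> real"
  assumes S: "finite S" "set_pmf \<mu> \<subseteq> S" "set_pmf \<nu> \<subseteq> S"
    and nonneg: "\<And>v w. 0 \<le> F v w"
    and support: "\<And>v w. F v w \<noteq> 0 \<Longrightarrow> v \<in> S \<and> w \<in> S"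
    and row: "\<And>v. v \<in> S \<Longrightarrow> (\<Sum>w\<in>S. F v w) = pmf \<mu> v"
    and col: "\<And>w. w \<in> S \<Longrightarrow> (\<Sum>v\<in>S. F v w) = pmf \<nu> w"
  obtains \<pi> where "\<pi> \<in> couplings \<mu> \<nu>" "\<And>v w. pmf \<pi> (v, w) = F v w"
proof -
  define \<pi> where "\<pi> = embed_pmf (case_prod F)"
  have outside: "case_prod F x = 0" if "x \<notin> S \<times> S" for x
    using support[of "fst x" "snd x"] that by (cases x) auto
  have "sum (case_prod F) (S \<times> S) = 1"
    using row sum_pmf_eq_1[OF S(1,2)] by (simp add: sum.cartesian_product')
  then have pmf_\<pi>: "pmf \<pi> (v, w) = F v w" for v w
    unfolding \<pi>_def using S(1) nonneg outside
    by (subst pmf_embed_pmf_finite[of "S \<times> S"]) (simp_all add: case_prod_beta)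
  have support_\<pi>: "set_pmf \<pi> \<subseteq> S \<times> S"
    using support by (auto simp: set_pmf_iff pmf_\<pi>)
  have "pmf (map_pmf fst \<pi>) v = pmf \<mu> v" for v
    unfolding pmf_map_fst_eq_sum[OF S(1,1) support_\<pi>] pmf_\<pi>
    using row outside[of "(v, _)"] S(2) by (cases "v \<in> S") (auto simp: set_pmf_iff)
  moreover have "pmf (map_pmf snd \<pi>) w = pmf \<nu> w" for w
    unfolding pmf_map_snd_eq_sum[OF S(1,1) support_\<pi>] pmf_\<pi>
    using col outside[of "(_, w)"] S(3) by (cases "w \<in> S") (auto simp: set_pmf_iff)
  ultimately have "\<pi> \<in> couplings \<mu> \<nu>"
    by (auto simp: couplings_def intro!: pmf_eqI)
  with that pmf_\<pi> show ?thesis by blast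
qed

definition residual :: "'v set \<Rightarrow> 'v pmf \<Rightarrow> ('v \<Rightarrow> 'v \<Rightarrow> real) \<Rightarrow> 'v \<Rightarrow> real" where
  "residual S \<mu> \<kappa> v = pmf \<mu> v - (\<Sum>w\<in>S. \<kappa> v w)"

lemma sum_residual:
  assumes "finite S" "set_pmf \<mu> \<subseteq> S"
  shows "sum (residual S \<mu> \<kappa>) S = 1 - (\<Sum>v\<in>S. \<Sum>w\<in>S. \<kappa> v w)"
  by (simp add: residual_def sum_subtractf sum_pmf_eq_1[OF assms])

definition partial_plan :: "'v set \<Rightarrow> 'v pmf \<Rightarrow> 'v pmf \<Rightarrow> ('v \<Rightarrow> 'v \<Rightarrow> real) \<Rightarrow> bool" where
  "partial_plan S \<mu> \<nu> \<kappa> \<longleftrightarrow> (\<forall>v w. 0 \<le> \<kappa> v w) \<and>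
     (\<forall>v\<in>S. 0 \<le> residual S \<mu> \<kappa> v) \<and> (\<forall>w\<in>S. 0 \<le> residual S \<nu> (\<lambda>w v. \<kappa> v w) w)"

lemma sum_product_over_total:
  fixes f g :: "'a \<Rightarrow> real"
  assumes "finite S" "\<And>x. x \<in> S \<Longrightarrow> 0 \<le> f x" "sum f S = sum g S" "x \<in> S"
  shows "(\<Sum>y\<in>S. f x * g y / sum f S) = f x"
proof -
  have "(\<Sum>y\<in>S. f x * g y / sum f S) = f x * sum f S / sum f S"
    unfolding assms(3) by (simp add: sum_distrib_left sum_divide_distrib)
  also have "\<dots> = f x"
    using assms(1,2,4) sum_nonneg_eq_0_iff[of S f] by (cases "sum f S = 0") auto
  finally show ?thesis .
qed

text \<open>The residual masses are coupled by the normalized product measure.\<close>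

lemma coupling_extends_partial_plan:
  assumes S: "finite S" "set_pmf \<mu> \<subseteq> S" "set_pmf \<nu> \<subseteq> S"
    and plan: "partial_plan S \<mu> \<nu> \<kappa>"
  obtains \<pi> where "\<pi> \<in> couplings \<mu> \<nu>"
    and "\<And>v w. (v, w) \<in> set_pmf \<pi> \<Longrightarrow> 0 < \<kappa> v w \<or>
           v \<in> S \<and> w \<in> S \<and> 0 < residual S \<mu> \<kappa> v \<and> 0 < residual S \<nu> (\<lambda>w v. \<kappa> v w) w"
proof -
  define row_res where "row_res = residual S \<mu> \<kappa>"
  define col_res where "col_res = residual S \<nu> (\<lambda>w v. \<kappa> v w)"
  define F where "F v w =
      (if v \<in> S \<and> w \<in> S then \<kappa> v w + row_res v * col_res w / sum row_res S else 0)" for v w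
  have \<kappa>: "0 \<le> \<kappa> v w" for v w
    using plan by (simp add: partial_plan_def)
  have row_res: "0 \<le> row_res v" and col_res: "0 \<le> col_res v" if "v \<in> S" for v
    using plan that by (auto simp: partial_plan_def row_res_def col_res_def)
  have total: "sum row_res S = sum col_res S"
    unfolding row_res_def col_res_def sum_residual[OF S(1,2)] sum_residual[OF S(1,3)]
    using sum.swap[of \<kappa> S S] by simp
  have row: "(\<Sum>w\<in>S. F v w) = pmf \<mu> v" if "v \<in> S" for v
    using sum_product_over_total[OF S(1) row_res total that] that
    by (simp add: F_def sum.distrib) (simp add: row_res_def residual_def)
  have col: "(\<Sum>v\<in>S. F v w) = pmf \<nu> w" if "w \<in> S" for w
    using sum_product_over_total[OF S(1) col_res total[symmetric] that] that
    by (simp add: F_def sum.distrib total mult.commute) (simp add: col_res_def residual_def)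
  have "0 \<le> F v w" for v w
    using \<kappa> row_res col_res by (simp add: F_def sum_nonneg)
  then obtain \<pi> where \<pi>: "\<pi> \<in> couplings \<mu> \<nu>" "\<And>v w. pmf \<pi> (v, w) = F v w"
    using ex_coupling_with_pmf[OF S _ _ row col] by (metis F_def)
  moreover have "0 < \<kappa> v w \<or> v \<in> S \<and> w \<in> S \<and> 0 < row_res v \<and> 0 < col_res w"
    if "(v, w) \<in> set_pmf \<pi>" for v w
  proof -
    have vw: "v \<in> S" "w \<in> S" and "\<kappa> v w + row_res v * col_res w / sum row_res S \<noteq> 0"
      using that by (auto simp: set_pmf_iff \<pi>(2) F_def split: if_splits)
    then have "\<kappa> v w \<noteq> 0 \<or> row_res v \<noteq> 0 \<and> col_res w \<noteq> 0" by auto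
    then show ?thesis
      using \<kappa>[of v w] row_res[OF vw(1)] col_res[OF vw(2)] vw by (auto simp: less_le)
  qed
  ultimately show ?thesis using that by (auto simp: row_res_def col_res_def)
qed

lemma finite_set_pmf_coupling:
  assumes "\<pi> \<in> couplings \<mu> \<nu>" "finite (set_pmf \<mu>)" "finite (set_pmf \<nu>)"
  shows "finite (set_pmf \<pi>)"
proof -
  have "set_pmf \<mu> = fst ` set_pmf \<pi>" "set_pmf \<nu> = snd ` set_pmf \<pi>"
    using assms(1) by (auto simp: couplings_def simp flip: set_map_pmf)
  then have "set_pmf \<pi> \<subseteq> set_pmf \<mu> \<times> set_pmf \<nu>"
    by (simp add: subset_fst_snd)
  then show ?thesis using assms(2,3) finite_subset by blast
qed

lemma transport_cost_eq_expectation: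
  assumes "finite (set_pmf \<pi>)"
  shows "transport_cost E \<pi> =
    ennreal (measure_pmf.expectation \<pi> (\<lambda>(v, w). real (graph_dist E v w)))"
  unfolding transport_cost_def case_prod_beta
  by (rule nn_integral_eq_integral) (auto intro: integrable_measure_pmf_finite assms)

lemma expectation_diff_coupling:
  fixes f :: "'v \<Rightarrow> real"
  assumes "\<pi> \<in> couplings \<mu> \<nu>" "finite (set_pmf \<pi>)"
  shows "measure_pmf.expectation \<pi> (\<lambda>(v, w). f v - f w) =
    measure_pmf.expectation \<mu> f - measure_pmf.expectation \<nu> f"
proof -
  have "map_pmf fst \<pi> = \<mu>" "map_pmf snd \<pi> = \<nu>" using assms(1) by (auto simp: couplings_def)
  then show ?thesis
    using assms(2) unfolding case_prod_beta
    by (auto simp: integrable_measure_pmf_finite simp flip: integral_map_pmf)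
qed

lemma wasserstein1_eq_expectation_diff:
  fixes f :: "'v \<Rightarrow> real"
  assumes fin: "finite (set_pmf \<mu>)" "finite (set_pmf \<nu>)"
    and lip: "\<And>v w. f v - f w \<le> real (graph_dist E v w)"
    and \<pi>: "\<pi> \<in> couplings \<mu> \<nu>"
    and tight: "\<And>v w. (v, w) \<in> set_pmf \<pi> \<Longrightarrow> real (graph_dist E v w) = f v - f w"
  shows "wasserstein1 E \<mu> \<nu> = measure_pmf.expectation \<mu> f - measure_pmf.expectation \<nu> f"
    (is "_ = ?gap")
proof -
  let ?cost = "\<lambda>\<rho>. measure_pmf.expectation \<rho> (\<lambda>(v, w). real (graph_dist E v w))"
  note fin_coupling = finite_set_pmf_coupling[OF _ fin]
  note cost = transport_cost_eq_expectation[OF fin_coupling]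
  have lower: "?gap \<le> ?cost \<rho>" if "\<rho> \<in> couplings \<mu> \<nu>" for \<rho>
    unfolding expectation_diff_coupling[OF that fin_coupling[OF that], symmetric]
    using fin_coupling[OF that] lip by (intro integral_mono integrable_measure_pmf_finite) auto
  have attained: "?cost \<pi> = ?gap"
    unfolding expectation_diff_coupling[OF \<pi> fin_coupling[OF \<pi>], symmetric] using tight
    by (intro integral_cong_AE) (auto simp: AE_measure_pmf_iff)
  have "wasserstein1 E \<mu> \<nu> = enn2real (transport_cost E \<pi>)"
    using \<pi> lower attained by (intro wasserstein1_eq_min) (auto simp: cost intro!: ennreal_leI)
  also have "\<dots> = ?cost \<pi>"
    using \<pi> by (simp add: cost case_prod_beta)
  finally show ?thesis using attained by simp
qed

section \<open>The lazy walk on a regular graph\<close>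

locale lazy_walk_graph = undirected_graph E for E :: "'v \<Rightarrow> 'v \<Rightarrow> bool" +
  fixes q :: nat and \<alpha> :: real
  assumes regular: "regular_graph (q + 1) E"
    and alpha_nonneg: "0 \<le> \<alpha>" and alpha_le_1: "\<alpha> \<le> 1"
begin

abbreviation N :: "'v \<Rightarrow> 'v set" where "N \<equiv> neighbors E"

abbreviation walk :: "'v \<Rightarrow> nat \<Rightarrow> 'v pmf" where "walk \<equiv> lazy_walk E \<alpha>"

abbreviation step_mean :: "'v \<Rightarrow> ('v \<Rightarrow> real) \<Rightarrow> real" where
  "step_mean v \<equiv> measure_pmf.expectation (lazy_step E \<alpha> v)"

abbreviation walk_mean :: "'v \<Rightarrow> nat \<Rightarrow> ('v \<Rightarrow> real) \<Rightarrow> real" where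
  "walk_mean X n \<equiv> measure_pmf.expectation (walk X n)"

definition edge_prob :: real where "edge_prob = (1 - \<alpha>) / (real q + 1)"

lemma edge_prob_nonneg: "0 \<le> edge_prob"
  using alpha_le_1 by (simp add: edge_prob_def)

lemma alpha_mult_eq: "\<alpha> * x = x - edge_prob * ((real q + 1) * x)"
  by (simp add: edge_prob_def field_simps)

lemma finite_neighbors [simp]: "finite (N v)" and card_neighbors [simp]: "card (N v) = q + 1"
  using regular by (auto simp: regular_graph_def)

definition laplacian :: "('v \<Rightarrow> real) \<Rightarrow> 'v \<Rightarrow> real" where
  "laplacian g v = (\<Sum>w\<in>N v. g w - g v)"

lemma laplacian_eq: "laplacian g v = (\<Sum>w\<in>N v. g w) - (real q + 1) * g v"
  by (simp add: laplacian_def sum_subtractf)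

lemma pmf_step: "pmf (lazy_step E \<alpha> u) w = (if w = u then \<alpha> else if E u w then edge_prob else 0)"
  using pmf_lazy_step[OF simple regular alpha_nonneg alpha_le_1] by (simp add: edge_prob_def)

lemma set_step_subset: "set_pmf (lazy_step E \<alpha> v) \<subseteq> insert v (N v)"
  by (auto simp: set_pmf_iff pmf_step split: if_splits)

lemma finite_set_step [simp]: "finite (set_pmf (lazy_step E \<alpha> v))"
  using set_step_subset[of v] by (rule finite_subset) simp

lemma finite_set_walk [simp]: "finite (set_pmf (walk X n))"
  by (induction n) auto

lemma integrable_walk [simp]: "integrable (measure_pmf (walk X n)) (g :: 'v \<Rightarrow> real)"
  by (rule integrable_measure_pmf_finite) simp

lemma sum_pmf_step:
  "(\<Sum>w\<in>insert v (N v). pmf (lazy_step E \<alpha> v) w * g w) =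
    \<alpha> * g v + edge_prob * (\<Sum>w\<in>N v. g w)"
proof -
  have "(\<Sum>w\<in>N v. pmf (lazy_step E \<alpha> v) w * g w) = (\<Sum>w\<in>N v. edge_prob * g w)"
    using adj_irrefl by (intro sum.cong) (auto simp: pmf_step)
  then show ?thesis
    using adj_irrefl[of v] by (simp add: pmf_step sum_distrib_left)
qed

lemma step_mean_eq: "step_mean v g = g v + edge_prob * laplacian g v"
proof -
  have "step_mean v g = (\<Sum>w\<in>insert v (N v). pmf (lazy_step E \<alpha> v) w * g w)"
    using set_step_subset[of v] by (subst integral_measure_pmf[of "insert v (N v)"]) auto
  then show ?thesis
    unfolding sum_pmf_step laplacian_eq by (simp add: alpha_mult_eq right_diff_distrib)
qed

lemma walk_mean_Suc:
  "walk_mean X (Suc n) g = walk_mean X n g + edge_prob * walk_mean X n (laplacian g)"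
proof -
  have "walk_mean X (Suc n) g = (\<Sum>v\<in>set_pmf (walk X n). pmf (walk X n) v *\<^sub>R step_mean v g)"
    by (simp add: pmf_expectation_bind[of "set_pmf (walk X n)"])
  also have "\<dots> = walk_mean X n (\<lambda>v. step_mean v g)"
    by (subst integral_measure_pmf[of "set_pmf (walk X n)"]) auto
  finally show ?thesis by (simp add: step_mean_eq)
qed

lemma pmf_walk_Suc:
  "pmf (walk X (Suc n)) w = \<alpha> * pmf (walk X n) w + edge_prob * (\<Sum>v\<in>N w. pmf (walk X n) v)"
proof -
  have step_sym: "pmf (lazy_step E \<alpha> v) w = pmf (lazy_step E \<alpha> w) v" for v
    using adj_sym by (auto simp: pmf_step)
  have "pmf (walk X (Suc n)) w = walk_mean X n (\<lambda>v. pmf (lazy_step E \<alpha> w) v)"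
    by (simp add: pmf_bind step_sym)
  also have "\<dots> = (\<Sum>v\<in>insert w (N w). pmf (walk X n) v * pmf (lazy_step E \<alpha> w) v)"
    using set_step_subset[of w]
    by (subst integral_measure_pmf[of "insert w (N w)"]) (auto simp: set_pmf_iff)
  also have "\<dots> = \<alpha> * pmf (walk X n) w + edge_prob * (\<Sum>v\<in>N w. pmf (walk X n) v)"
    using sum_pmf_step[of w "pmf (walk X n)"] by (simp add: mult.commute)
  finally show ?thesis .
qed

lemma walk_mean_harmonic:
  assumes "\<And>v. laplacian h v = 0"
  shows "walk_mean X n h = h X"
proof (induction n)
  case (Suc n)
  have "laplacian h = (\<lambda>_. 0)" using assms by blast
  with Suc show ?case unfolding walk_mean_Suc by simp
qed simp

lemma walk_mean_linear_growth:
  assumes "\<And>v. laplacian g v = c * h v" and "\<And>v. laplacian h v = 0"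
  shows "walk_mean X n g = g X + edge_prob * c * real n * h X"
proof (induction n)
  case (Suc n)
  have "laplacian g = (\<lambda>v. c * h v)" using assms(1) by blast
  then have "walk_mean X n (laplacian g) = c * h X"
    by (simp add: walk_mean_harmonic[OF assms(2)])
  with Suc show ?case unfolding walk_mean_Suc by (simp add: algebra_simps)
qed simp

lemma walk_mean_geometric_decay:
  assumes "\<And>v. laplacian g v \<le> - c * g v" and "0 \<le> 1 - edge_prob * c"
  shows "walk_mean X n g \<le> (1 - edge_prob * c) ^ n * g X"
proof (induction n)
  case (Suc n)
  have "walk_mean X n (laplacian g) \<le> walk_mean X n (\<lambda>v. - c * g v)"
    by (intro integral_mono integrable_walk assms(1))
  then have "walk_mean X (Suc n) g \<le> (1 - edge_prob * c) * walk_mean X n g"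
    unfolding walk_mean_Suc using mult_left_mono[OF _ edge_prob_nonneg]
    by (fastforce simp: algebra_simps)
  also have "\<dots> \<le> (1 - edge_prob * c) * ((1 - edge_prob * c) ^ n * g X)"
    using Suc assms(2) by (rule mult_left_mono)
  finally show ?case by simp
qed simp

end

section \<open>The lazy walk on a regular tree\<close>

definition radial_sum :: "nat \<Rightarrow> (nat \<Rightarrow> real) \<Rightarrow> nat \<Rightarrow> real" where
  "radial_sum q \<phi> r = (if r = 0 then (real q + 1) * \<phi> 1 else \<phi> (r - 1) + real q * \<phi> (r + 1))"

primrec radial_prob :: "real \<Rightarrow> nat \<Rightarrow> nat \<Rightarrow> nat \<Rightarrow> real" where
  "radial_prob \<alpha> q 0 = (\<lambda>r. if r = 0 then 1 else 0)"
| "radial_prob \<alpha> q (Suc n) = (\<lambda>r. \<alpha> * radial_prob \<alpha> q n r +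
     (1 - \<alpha>) / (real q + 1) * radial_sum q (radial_prob \<alpha> q n) r)"

lemma radial_sum_add2_le:
  assumes "\<And>r. \<phi> (r + 2) \<le> \<phi> r"
  shows "radial_sum q \<phi> (r + 2) \<le> radial_sum q \<phi> r"
proof -
  have "real q * \<phi> (r + 3) \<le> real q * \<phi> (r + 1)"
    using assms[of "r + 1"] by (intro mult_left_mono) (auto simp: eval_nat_numeral)
  then show ?thesis
    using assms[of "r - 1"] by (auto simp: radial_sum_def eval_nat_numeral algebra_simps)
qed

text \<open>Without enough laziness, \<open>radial_prob \<alpha> q n\<close> is monotone only along steps of
  length two, because of the parity of the walk.\<close>

lemma radial_prob_add2_le:
  assumes "0 \<le> \<alpha>" "\<alpha> \<le> 1"
  shows "radial_prob \<alpha> q n (r + 2) \<le> radial_prob \<alpha> q n r"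
proof (induction n arbitrary: r)
  case (Suc n)
  show ?case
    using assms Suc radial_sum_add2_le[of "radial_prob \<alpha> q n" q r]
    by (simp del: add_2_eq_Suc' add: add_mono mult_left_mono divide_right_mono)
qed auto

lemma radial_prob_antimono:
  assumes "0 \<le> \<alpha>" "\<alpha> \<le> 1" "r \<le> r'" "even (r + r')"
  shows "radial_prob \<alpha> q n r' \<le> radial_prob \<alpha> q n r"
proof -
  have "radial_prob \<alpha> q n (r + 2 * k) \<le> radial_prob \<alpha> q n r" for k
  proof (induction k)
    case (Suc k)
    then show ?case
      using radial_prob_add2_le[OF assms(1,2), of q n "r + 2 * k"] by (simp add: algebra_simps)
  qed auto
  moreover obtain k where "r' = r + 2 * k"
    using assms(3,4) by (metis even_add even_diff_nat evenE le_add_diff_inverse)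
  ultimately show ?thesis by simp
qed

locale lazy_walk_tree = tree_graph E + lazy_walk_graph E q \<alpha>
  for E :: "'v \<Rightarrow> 'v \<Rightarrow> bool" and q :: nat and \<alpha> :: real +
  assumes q_pos: "0 < q"
begin

lemma finite_children [simp]: "finite (children u v)"
  by (rule finite_subset[OF _ finite_neighbors[of v]]) (auto simp: children_def)

lemma card_children: "v \<noteq> u \<Longrightarrow> card (children u v) = q"
  using card_neighbors[of v] neighbors_eq_parent_children[of v u] parent_notin_children[of v u]
  by simp

lemma sum_neighbors_eq:
  "v \<noteq> u \<Longrightarrow> (\<Sum>w\<in>N v. g w) = g (parent u v) + (\<Sum>w\<in>children u v. g w)"
  using parent_notin_children[of v u] by (simp add: neighbors_eq_parent_children[of v u])

lemma sum_neighbors_radial: "(\<Sum>w\<in>N v. \<phi> (D w u)) = radial_sum q \<phi> (D v u)"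
proof (cases "v = u")
  case True
  then have "(\<Sum>w\<in>N v. \<phi> (D w u)) = (\<Sum>w\<in>N v. \<phi> 1)"
    by (intro sum.cong) (auto simp: dist_adj adj_sym)
  then show ?thesis using True by (simp add: radial_sum_def)
next
  case False
  have "(\<Sum>w\<in>children u v. \<phi> (D w u)) = (\<Sum>w\<in>children u v. \<phi> (D v u + 1))"
    by (intro sum.cong) (auto simp: children_def)
  then show ?thesis
    using False dist_parent[OF False] by (simp add: sum_neighbors_eq card_children radial_sum_def)
qed

lemma pmf_walk: "pmf (walk X n) v = radial_prob \<alpha> q n (D v X)"
proof (induction n arbitrary: v)
  case 0
  then show ?case by (auto simp: indicator_def)
next
  case (Suc n)
  then show ?case
    unfolding pmf_walk_Suc by (simp add: sum_neighbors_radial edge_prob_def)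
qed

lemma pmf_walk_antimono:
  assumes "D v X \<le> D w Y" "even (D v X + D w Y)"
  shows "pmf (walk Y n) w \<le> pmf (walk X n) v"
  unfolding pmf_walk using assms alpha_nonneg alpha_le_1 by (intro radial_prob_antimono)

end

section \<open>Optimal transport between two walks\<close>

context lazy_walk_tree
begin

lemma wasserstein1_walk_if_plan:
  assumes S: "finite S" "set_pmf (walk X n) \<subseteq> S" "set_pmf (walk Y n) \<subseteq> S"
    and plan: "partial_plan S (walk X n) (walk Y n) \<kappa>"
    and tight: "\<And>v w. 0 < \<kappa> v w \<Longrightarrow> real (D v w) = potential X Y v - potential X Y w"
    and row: "\<And>v. v \<in> S \<Longrightarrow> 0 < residual S (walk X n) \<kappa> v \<Longrightarrow> v \<in> half_tree X Y"
    and col: "\<And>w. w \<in> S \<Longrightarrow> 0 < residual S (walk Y n) (\<lambda>w v. \<kappa> v w) w \<Longrightarrow> w \<in> half_tree Y X"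
  shows "wasserstein1 E (walk X n) (walk Y n) =
    walk_mean X n (potential X Y) - walk_mean Y n (potential X Y)"
proof -
  obtain \<pi> where \<pi>: "\<pi> \<in> couplings (walk X n) (walk Y n)"
    and support: "\<And>v w. (v, w) \<in> set_pmf \<pi> \<Longrightarrow> 0 < \<kappa> v w \<or> v \<in> S \<and> w \<in> S \<and>
      0 < residual S (walk X n) \<kappa> v \<and> 0 < residual S (walk Y n) (\<lambda>w v. \<kappa> v w) w"
    using coupling_extends_partial_plan[OF S plan] by blast
  show ?thesis
  proof (rule wasserstein1_eq_expectation_diff[OF _ _ potential_lipschitz \<pi>])
    fix v w assume "(v, w) \<in> set_pmf \<pi>"
    from support[OF this] show "real (D v w) = potential X Y v - potential X Y w"
    proof (elim disjE conjE)
      assume "0 < \<kappa> v w"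
      then show ?thesis by (rule tight)
    next
      assume "v \<in> S" "w \<in> S" "0 < residual S (walk X n) \<kappa> v"
        "0 < residual S (walk Y n) (\<lambda>w v. \<kappa> v w) w"
      then show ?thesis by (intro potential_tight row col)
    qed
  qed auto
qed

definition stay_plan :: "'v \<Rightarrow> 'v \<Rightarrow> nat \<Rightarrow> 'v \<Rightarrow> 'v \<Rightarrow> real" where
  "stay_plan X Y n v w = (if v = w then min (pmf (walk X n) v) (pmf (walk Y n) v) else 0)"

lemma stay_plan_swap: "stay_plan X Y n v w = stay_plan Y X n w v"
  by (auto simp: stay_plan_def min.commute)

lemma residual_stay_plan:
  "finite S \<Longrightarrow> v \<in> S \<Longrightarrow>
    residual S (walk X n) (stay_plan X Y n) v = max 0 (pmf (walk X n) v - pmf (walk Y n) v)"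
  by (simp add: residual_def stay_plan_def)

lemma wasserstein1_walk_even:
  assumes "even (D X Y)"
  shows "wasserstein1 E (walk X n) (walk Y n) =
    walk_mean X n (potential X Y) - walk_mean Y n (potential X Y)"
proof (rule wasserstein1_walk_if_plan[where \<kappa> = "stay_plan X Y n"])
  let ?S = "set_pmf (walk X n) \<union> set_pmf (walk Y n)"
  have swap: "(\<lambda>w v. stay_plan X Y n v w) = stay_plan Y X n"
    by (intro ext) (rule stay_plan_swap)
  show "set_pmf (walk X n) \<subseteq> ?S" "set_pmf (walk Y n) \<subseteq> ?S" by auto
  show "finite ?S" by simp
  then show "partial_plan ?S (walk X n) (walk Y n) (stay_plan X Y n)"
    unfolding partial_plan_def swap by (simp add: residual_stay_plan) (simp add: stay_plan_def)
  have closer: "v \<in> half_tree Z Z'"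
    if "pmf (walk Z' n) v < pmf (walk Z n) v" "even (D Z Z')" for v Z Z'
  proof -
    have "\<not> D v Z' \<le> D v Z"
      using that pmf_walk_antimono[of v Z' v Z n] even_dist_sum[of v Z Z'] by auto
    then show ?thesis by simp
  qed
  have even': "even (D Y X)" using assms by (simp add: dist_commute)
  show "v \<in> half_tree X Y" if "v \<in> ?S" "0 < residual ?S (walk X n) (stay_plan X Y n) v" for v
    using that by (intro closer[OF _ assms]) (simp add: residual_stay_plan)
  show "w \<in> half_tree Y X"
    if "w \<in> ?S" "0 < residual ?S (walk Y n) (\<lambda>w v. stay_plan X Y n v w) w" for w
    using that unfolding swap by (intro closer[OF _ even']) (simp add: residual_stay_plan)
  show "real (D v w) = potential X Y v - potential X Y w" if "0 < stay_plan X Y n v w" for v w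
    using that by (cases "v = w") (simp_all add: stay_plan_def)
qed

text \<open>For odd distance the probabilities of the two walks at the same vertex are not comparable,
  as the distances to \<open>X\<close> and \<open>Y\<close> have different parities; across an edge the parities agree.\<close>

definition shift_plan :: "'v \<Rightarrow> 'v \<Rightarrow> nat \<Rightarrow> 'v \<Rightarrow> 'v \<Rightarrow> real" where
  "shift_plan X Y n v w =
     (if w \<in> half_tree X Y \<and> v \<in> children Y w then pmf (walk Y n) w / real q
      else if v \<in> half_tree Y X \<and> w \<in> children X v then pmf (walk X n) v / real q
      else 0)"

lemma shift_plan_swap: "shift_plan X Y n v w = shift_plan Y X n w v"
proof -
  have "\<not> (w \<in> half_tree X Y \<and> v \<in> children Y w \<and> v \<in> half_tree Y X)"
    using half_tree_child[of w X Y v] by auto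
  then show ?thesis
    by (auto simp: shift_plan_def simp del: in_half_tree)
qed

lemma shift_plan_nonneg: "0 \<le> shift_plan X Y n v w"
  by (simp add: shift_plan_def)

lemma shift_plan_tight:
  assumes "0 < shift_plan X Y n v w"
  shows "real (D v w) = potential X Y v - potential X Y w"
proof -
  consider "w \<in> half_tree X Y" "v \<in> children Y w" | "v \<in> half_tree Y X" "w \<in> children X v"
    using assms by (auto simp: shift_plan_def split: if_splits)
  then show ?thesis
  proof cases
    case 1
    with half_tree_child have "v \<in> half_tree X Y" by blast
    with 1 show ?thesis
      using dist_adj[of w v] dist_commute[of v w]
      by (simp add: odd_ext_def midpoint_offset_def children_def)
  next
    case 2
    with half_tree_child have "w \<in> half_tree Y X" by blast
    with 2 show ?thesis
      using dist_adj[of v w] by (simp add: odd_ext_def midpoint_offset_def children_def)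
  qed
qed

lemma residual_shift_plan_far:
  assumes far: "v \<in> half_tree Y X" and S: "finite S" "v \<in> set_pmf (walk X n) \<Longrightarrow> children X v \<subseteq> S"
  shows "residual S (walk X n) (shift_plan X Y n) v = 0"
proof -
  have "w \<notin> half_tree X Y" if "v \<in> children Y w" for w
    using half_tree_child[OF _ that, of X] far by auto
  then have "shift_plan X Y n v w =
      (if w \<in> children X v then pmf (walk X n) v / real q else 0)" for w
    using far by (auto simp: shift_plan_def simp del: in_half_tree)
  then have "(\<Sum>w\<in>S. shift_plan X Y n v w) = (\<Sum>w\<in>S \<inter> children X v. pmf (walk X n) v / real q)"
    by (simp only: sum.inter_restrict[OF S(1)])
  also have "\<dots> = pmf (walk X n) v"
  proof (cases "v \<in> set_pmf (walk X n)")
    case True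
    with S(2) have "S \<inter> children X v = children X v" by blast
    moreover have "v \<noteq> X" using far by auto
    ultimately show ?thesis using q_pos by (simp add: card_children)
  qed (simp add: set_pmf_iff)
  finally show ?thesis by (simp add: residual_def)
qed

lemma residual_shift_plan_near:
  assumes near: "v \<in> half_tree X Y" and "odd (D X Y)" "finite S"
  shows "0 \<le> residual S (walk X n) (shift_plan X Y n) v"
proof -
  have "v \<noteq> Y" using near by auto
  note parent = adj_parent[OF this] dist_parent[OF this]
  have "pmf (walk Y n) (parent Y v) \<le> pmf (walk X n) v"
    using near parent(2) even_dist_sum[of v X Y] assms(2) by (intro pmf_walk_antimono) auto
  moreover have "pmf (walk Y n) (parent Y v) / real q \<le> pmf (walk Y n) (parent Y v)"
    using q_pos by (simp add: divide_le_eq mult_le_cancel_left1)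
  ultimately have "pmf (walk Y n) (parent Y v) / real q \<le> pmf (walk X n) v"
    by linarith
  moreover have "shift_plan X Y n v w =
      (if v \<in> children Y w \<and> w \<in> half_tree X Y then pmf (walk Y n) w / real q else 0)" for w
    using near by (simp add: shift_plan_def)
  ultimately have "shift_plan X Y n v w \<le> (if w = parent Y v then pmf (walk X n) v else 0)" for w
    by (cases "w = parent Y v") (use parent_eq_if_child[of v Y w] in auto)
  then have "(\<Sum>w\<in>S. shift_plan X Y n v w) \<le>
      (\<Sum>w\<in>S. if w = parent Y v then pmf (walk X n) v else 0)"
    by (rule sum_mono)
  also have "\<dots> \<le> pmf (walk X n) v" using assms(3) by simp
  finally show ?thesis by (simp add: residual_def)
qed

lemma wasserstein1_walk_odd:
  assumes "odd (D X Y)"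
  shows "wasserstein1 E (walk X n) (walk Y n) =
    walk_mean X n (potential X Y) - walk_mean Y n (potential X Y)"
proof (rule wasserstein1_walk_if_plan[where \<kappa> = "shift_plan X Y n"])
  let ?T = "set_pmf (walk X n) \<union> set_pmf (walk Y n)"
  define S where "S = ?T \<union> (\<Union>v\<in>?T. N v)"
  show S: "finite S" by (simp add: S_def)
  show "set_pmf (walk X n) \<subseteq> S" "set_pmf (walk Y n) \<subseteq> S" by (auto simp: S_def)
  have odd': "odd (D Y X)" using assms by (simp add: dist_commute)
  have halves: "v \<in> half_tree X Y \<or> v \<in> half_tree Y X" for v
    using even_dist_sum[of v X Y] assms by (auto simp: not_less_iff_gr_or_eq)
  have far: "residual S (walk X n) (shift_plan X Y n) v = 0" if "v \<in> half_tree Y X" for v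
    using that S by (rule residual_shift_plan_far) (auto simp: S_def children_def)
  have far': "residual S (walk Y n) (shift_plan Y X n) w = 0" if "w \<in> half_tree X Y" for w
    using that S by (rule residual_shift_plan_far) (auto simp: S_def children_def)
  have swap: "(\<lambda>w v. shift_plan X Y n v w) = shift_plan Y X n"
    by (intro ext) (rule shift_plan_swap)
  have row: "0 \<le> residual S (walk X n) (shift_plan X Y n) v" for v
    using halves[of v] far[of v] residual_shift_plan_near[OF _ assms S, of v n]
    by (auto simp del: in_half_tree)
  have col: "0 \<le> residual S (walk Y n) (shift_plan Y X n) w" for w
    using halves[of w] far'[of w] residual_shift_plan_near[OF _ odd' S, of w n]
    by (auto simp del: in_half_tree)
  show "partial_plan S (walk X n) (walk Y n) (shift_plan X Y n)"
    using row col shift_plan_nonneg by (simp add: partial_plan_def swap)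
  show "v \<in> half_tree X Y" if "0 < residual S (walk X n) (shift_plan X Y n) v" for v
    using that halves[of v] far[of v] by auto
  show "w \<in> half_tree Y X" if "0 < residual S (walk Y n) (\<lambda>w v. shift_plan X Y n v w) w" for w
    using that halves[of w] far'[of w] unfolding swap by auto
qed (rule shift_plan_tight)

lemma wasserstein1_walk:
  "wasserstein1 E (walk X n) (walk Y n) =
    walk_mean X n (potential X Y) - walk_mean Y n (potential X Y)"
  using wasserstein1_walk_odd wasserstein1_walk_even by blast

end

section \<open>Radial profiles\<close>

text \<open>For a balanced profile, the value of its odd extension one step across the midpoint is the
  one obtained by continuing the profile. For even \<open>d\<close> the condition reads \<open>\<phi> (d / 2) = 0\<close>.\<close>

definition balanced :: "nat \<Rightarrow> (nat \<Rightarrow> real) \<Rightarrow> bool" where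
  "balanced d \<phi> \<longleftrightarrow> \<phi> (d div 2) + \<phi> ((d + 1) div 2) = 0"

definition profile_laplacian :: "nat \<Rightarrow> (nat \<Rightarrow> real) \<Rightarrow> nat \<Rightarrow> real" where
  "profile_laplacian q \<phi> r = real q * \<phi> (r + 1) + \<phi> (r - 1) - (real q + 1) * \<phi> r"

definition floor_power :: "nat \<Rightarrow> nat \<Rightarrow> real" where
  "floor_power q d = 1 / real q ^ (d div 2)"

definition ceil_power :: "nat \<Rightarrow> nat \<Rightarrow> real" where
  "ceil_power q d = 1 / real q ^ ((d + 1) div 2)"

text \<open>The coefficient and the center are the values for which the two profiles below are
  balanced.\<close>

definition profile_coeff :: "nat \<Rightarrow> nat \<Rightarrow> real" where
  "profile_coeff q d = 2 / (floor_power q d + ceil_power q d)"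

definition profile_center :: "nat \<Rightarrow> nat \<Rightarrow> real" where
  "profile_center q d =
    (real (d div 2) * floor_power q d + real ((d + 1) div 2) * ceil_power q d) /
    (floor_power q d + ceil_power q d)"

definition harmonic_profile :: "nat \<Rightarrow> nat \<Rightarrow> nat \<Rightarrow> real" where
  "harmonic_profile q d r = 1 - profile_coeff q d / real q ^ r"

definition decaying_profile :: "nat \<Rightarrow> nat \<Rightarrow> nat \<Rightarrow> real" where
  "decaying_profile q d r = profile_coeff q d * (real r - profile_center q d) / real q ^ r"

definition compensated_profile :: "nat \<Rightarrow> nat \<Rightarrow> nat \<Rightarrow> real" where
  "compensated_profile q d r = midpoint_offset d r + decaying_profile q d r"

lemma half_powers_pos:
  assumes "0 < q"
  shows "0 < floor_power q d" "0 < ceil_power q d"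
  using assms by (simp_all add: floor_power_def ceil_power_def)

lemma balanced_harmonic_profile:
  assumes "0 < q"
  shows "balanced d (harmonic_profile q d)"
proof -
  have "floor_power q d + ceil_power q d \<noteq> 0"
    using half_powers_pos[OF assms, of d] by linarith
  then have "profile_coeff q d * (floor_power q d + ceil_power q d) = 2"
    by (simp add: profile_coeff_def del: distrib_left_numeral)
  then show ?thesis
    by (simp add: balanced_def harmonic_profile_def floor_power_def ceil_power_def distrib_left)
qed

lemma balanced_decaying_profile:
  assumes "0 < q"
  shows "balanced d (decaying_profile q d)"
proof -
  have "profile_center q d * (floor_power q d + ceil_power q d) =
      real (d div 2) * floor_power q d + real ((d + 1) div 2) * ceil_power q d"
    using half_powers_pos[OF assms, of d] by (simp add: profile_center_def)
  then have "profile_coeff q d * ((real (d div 2) - profile_center q d) * floor_power q d +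
      (real ((d + 1) div 2) - profile_center q d) * ceil_power q d) = 0"
    by (simp add: algebra_simps)
  then show ?thesis
    by (simp add: balanced_def decaying_profile_def floor_power_def ceil_power_def distrib_left)
qed

lemma half_sum: "d div 2 + (d + 1) div 2 = (d :: nat)"
  by linarith

lemma balanced_compensated_profile:
  assumes "0 < q"
  shows "balanced d (compensated_profile q d)"
proof -
  have "real (d div 2) + real ((d + 1) div 2) = real d"
    by (simp only: half_sum flip: of_nat_add)
  then show ?thesis
    using balanced_decaying_profile[OF assms, of d]
    by (simp add: balanced_def compensated_profile_def midpoint_offset_def)
qed

lemma profile_laplacian_harmonic:
  assumes "0 < q" "0 < r"
  shows "profile_laplacian q (harmonic_profile q d) r = 0"
proof -
  obtain k where "r = Suc k" using assms(2) gr0_implies_Suc by blast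
  then show ?thesis
    using assms(1) by (simp add: profile_laplacian_def harmonic_profile_def field_simps)
qed

lemma profile_laplacian_decaying:
  assumes "0 < q" "0 < r"
  shows "profile_laplacian q (decaying_profile q d) r = (real q - 1) * (harmonic_profile q d r - 1)"
proof -
  obtain k where "r = Suc k" using assms(2) gr0_implies_Suc by blast
  then show ?thesis
    using assms(1)
    by (simp add: profile_laplacian_def decaying_profile_def harmonic_profile_def field_simps)
qed

lemma profile_laplacian_compensated:
  assumes "0 < q" "0 < r"
  shows "profile_laplacian q (compensated_profile q d) r = (real q - 1) * harmonic_profile q d r"
proof -
  have "real (r - 1) = real r - 1" using assms(2) by simp
  then have "profile_laplacian q (midpoint_offset d) r = real q - 1"
    by (simp add: profile_laplacian_def midpoint_offset_def algebra_simps add_divide_distrib)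
  then show ?thesis
    using profile_laplacian_decaying[OF assms, of d]
    by (simp add: profile_laplacian_def compensated_profile_def algebra_simps)
qed

lemma decaying_profile_bound:
  assumes "1 < q"
  shows "\<exists>K. \<forall>r. \<bar>decaying_profile q d r\<bar> \<le> K * (1 / sqrt (real q) ^ r)"
proof -
  let ?factor = "\<lambda>r. profile_coeff q d * (real r / sqrt (real q) ^ r)
    - profile_coeff q d * profile_center q d * inverse (sqrt (real q) ^ r)"
  have "?factor \<longlonglongrightarrow> profile_coeff q d * 0 - profile_coeff q d * profile_center q d * 0"
    using assms by (intro tendsto_intros lim_n_over_pown LIMSEQ_inverse_realpow_zero) auto
  then have "Bseq ?factor"
    by (intro convergent_imp_Bseq) (auto simp: convergent_def)
  then obtain K where K: "\<And>r. \<bar>?factor r\<bar> \<le> K"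
    unfolding Bseq_def by auto
  have "\<bar>decaying_profile q d r\<bar> \<le> K * (1 / sqrt (real q) ^ r)" for r
  proof -
    have "real q ^ r = sqrt (real q) ^ r * sqrt (real q) ^ r"
      by (simp flip: power_mult_distrib)
    then have "decaying_profile q d r = ?factor r * (1 / sqrt (real q) ^ r)"
      by (simp add: decaying_profile_def inverse_eq_divide diff_divide_distrib
          left_diff_distrib right_diff_distrib)
    then have "\<bar>decaying_profile q d r\<bar> = \<bar>?factor r\<bar> * (1 / sqrt (real q) ^ r)"
      by (simp only: abs_mult) simp
    also have "\<dots> \<le> K * (1 / sqrt (real q) ^ r)"
      using K by (intro mult_right_mono) auto
    finally show ?thesis .
  qed
  then show ?thesis by blast
qed

subsection \<open>The coefficients of the expansion\<close>

lemma floor_power_mult_ceil_power: "floor_power q d * ceil_power q d = 1 / real q ^ d"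
  by (simp only: floor_power_def ceil_power_def times_divide_times_eq mult_1 half_sum
      flip: power_add)

lemma floor_power_even: "even d \<Longrightarrow> floor_power q d = ceil_power q d"
  by (simp add: floor_power_def ceil_power_def)

lemma floor_power_odd: "0 < q \<Longrightarrow> odd d \<Longrightarrow> floor_power q d = real q * ceil_power q d"
  by (auto simp: floor_power_def ceil_power_def elim!: oddE)

lemma profile_coeff_div_power:
  assumes "0 < q"
  shows "profile_coeff q d / real q ^ d =
    (real q * ceil_power q d + floor_power q d) / (real q + 1)"
proof -
  define a b where "a = floor_power q d" and "b = ceil_power q d"
  have "profile_coeff q d / real q ^ d = 2 / (a + b) * (a * b)"
    unfolding a_def b_def by (simp add: profile_coeff_def floor_power_mult_ceil_power)
  also have "\<dots> = (real q * b + a) / (real q + 1)"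
  proof -
    have pos: "0 < a" "0 < b" using half_powers_pos[OF assms] by (auto simp: a_def b_def)
    consider "a = b" | "a = real q * b"
      using floor_power_even floor_power_odd[OF assms] a_def b_def by blast
    then show ?thesis
    proof cases
      case 1
      then show ?thesis using pos by (simp add: field_simps)
    next
      case 2
      then have "a + b = (real q + 1) * b" by (simp add: algebra_simps)
      then show ?thesis using pos 2 by (simp add: field_simps)
    qed
  qed
  finally show ?thesis by (simp add: a_def b_def)
qed

lemma floor_half: "\<lfloor>real d / 2\<rfloor> = int (d div 2)"
  by linarith

lemma ceiling_half: "\<lceil>real d / 2\<rceil> = int ((d + 1) div 2)"
  by linarith

lemma
  assumes "0 < q"
  shows powi_minus_floor_half: "real q powi (- \<lfloor>real d / 2\<rfloor>) = floor_power q d"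
    and powi_1_minus_floor_half: "real q powi (1 - \<lfloor>real d / 2\<rfloor>) = real q * floor_power q d"
    and powi_1_minus_ceiling_half: "real q powi (1 - \<lceil>real d / 2\<rceil>) = real q * ceil_power q d"
proof -
  have "real q powi (1 - int m) = real q * (1 / real q ^ m)" for m
    using assms by (simp add: power_int_diff)
  then show "real q powi (1 - \<lfloor>real d / 2\<rfloor>) = real q * floor_power q d"
    and "real q powi (1 - \<lceil>real d / 2\<rceil>) = real q * ceil_power q d"
    by (simp_all only: floor_half ceiling_half floor_power_def ceil_power_def)
  show "real q powi (- \<lfloor>real d / 2\<rfloor>) = floor_power q d"
    by (simp add: floor_half floor_power_def power_int_minus inverse_eq_divide)
qed

lemma A_SRW_eq:
  assumes "0 < q"
  shows "A_SRW \<alpha> d q = 2 * ((1 - \<alpha>) / (real q + 1) * (real q - 1) * harmonic_profile q d d)"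
proof -
  have "harmonic_profile q d d =
      (real q + 1 - real q * ceil_power q d - floor_power q d) / (real q + 1)"
    unfolding harmonic_profile_def profile_coeff_div_power[OF assms] by (simp add: field_simps)
  then show ?thesis
    by (simp add: A_SRW_def Let_def powi_minus_floor_half[OF assms]
        powi_1_minus_ceiling_half[OF assms] power2_eq_square)
qed

lemma profile_center_even:
  assumes "0 < q" "even d"
  shows "profile_center q d = real (d div 2)"
proof -
  have "profile_center q d * (2 * ceil_power q d) = real (d div 2) * (2 * ceil_power q d)"
    using assms half_powers_pos[OF assms(1), of d]
    by (simp add: profile_center_def floor_power_even)
  then show ?thesis using half_powers_pos[OF assms(1), of d] by simp
qed

lemma profile_center_odd:
  assumes "0 < q" "odd d"
  shows "profile_center q d = real (d div 2) + 1 / (real q + 1)"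
proof -
  let ?b = "ceil_power q d"
  have "real ((d + 1) div 2) = real (d div 2) + 1"
    using assms(2) by (auto elim!: oddE)
  then have "profile_center q d = ((real q + 1) * real (d div 2) + 1) * ?b / ((real q + 1) * ?b)"
    unfolding profile_center_def floor_power_odd[OF assms] by (simp add: algebra_simps)
  then show ?thesis
    using half_powers_pos(2)[OF assms(1), of d] by (simp add: add_divide_distrib)
qed

lemma B_SRW_eq:
  assumes "0 < q"
  shows "B_SRW \<alpha> d q = 2 * compensated_profile q d d"
proof -
  define m where "m = real (d div 2)"
  define m' where "m' = real ((d + 1) div 2)"
  define b where "b = ceil_power q d"
  define a where "a = floor_power q d"
  define P where "P = real q + 1"
  have P: "0 < P" "real q = P - 1" by (simp_all add: P_def)
  have lhs: "B_SRW \<alpha> d q = real d + 2 * (m * a + m' * (real q * b)) / P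
      + 2 * (real q * a - real q * b) / P\<^sup>2"
    unfolding B_SRW_def Let_def powi_minus_floor_half[OF assms]
      powi_1_minus_floor_half[OF assms] powi_1_minus_ceiling_half[OF assms]
    by (simp only: floor_half ceiling_half of_int_of_nat_eq m_def m'_def a_def b_def P_def)
  have "compensated_profile q d d =
      real d / 2 + (real d - profile_center q d) * (profile_coeff q d / real q ^ d)"
    by (simp add: compensated_profile_def midpoint_offset_def decaying_profile_def)
  then have rhs: "2 * compensated_profile q d d =
      real d + 2 * (real d - profile_center q d) * (real q * b + a) / P"
    by (simp add: profile_coeff_div_power[OF assms] a_def b_def P_def)
  show ?thesis
  proof (cases "even d")
    case True
    then have params: "real d = 2 * m" "m' = m" "a = b" "profile_center q d = m"
      using profile_center_even[OF assms] floor_power_even[of d q]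
      by (auto simp: m_def m'_def a_def b_def elim!: evenE)
    show ?thesis
      unfolding lhs rhs params P(2) using P(1) by (simp add: field_simps)
  next
    case False
    then have params: "real d = 2 * m + 1" "m' = m + 1" "a = real q * b"
        "profile_center q d = m + 1 / P"
      using profile_center_odd[OF assms] floor_power_odd[OF assms]
      by (auto simp: m_def m'_def a_def b_def P_def elim!: oddE)
    show ?thesis
      unfolding lhs rhs params P(2) using P(1) by (simp add: field_simps power2_eq_square)
  qed
qed

section \<open>Asymptotics of the expected potential\<close>

context tree_graph
begin

lemma odd_ext_cong: "(\<And>r. 0 < r \<Longrightarrow> \<phi> r = \<psi> r) \<Longrightarrow> odd_ext X Y \<phi> v = odd_ext X Y \<psi> v"
  by (auto simp: odd_ext_def)

lemma odd_ext_parent: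
  assumes "balanced (D X Y) \<phi>" and near: "v \<in> half_tree X Y"
  shows "odd_ext X Y \<phi> (parent Y v) = \<phi> (D v Y - 1)"
proof -
  let ?w = "parent Y v"
  have "v \<noteq> Y" using near by auto
  then have w: "E v ?w" "D v Y = D ?w Y + 1"
    using adj_parent dist_parent by auto
  have across: "D X Y + 1 = D v Y + D ?w X" if "D ?w Y \<le> D ?w X"
    using four_point[of v X ?w Y] dist_adj[OF w(1)] near that by simp
  consider "D ?w X < D ?w Y" | "D ?w X = D ?w Y" | "D ?w Y < D ?w X" by linarith
  then show ?thesis
  proof cases
    case 1
    then show ?thesis using w(2) by (simp add: odd_ext_def)
  next
    case 2
    then have "D X Y = 2 * D ?w Y" using across w(2) by simp
    then show ?thesis using 2 w(2) assms(1) by (simp add: odd_ext_def balanced_def)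
  next
    case 3
    then have X: "D ?w X = D ?w Y + 1" using dist_adj_le[OF w(1), of X] near w(2) by simp
    then have "D X Y = 2 * D ?w Y + 1" using across w(2) by simp
    then show ?thesis using X w(2) assms(1) by (simp add: odd_ext_def balanced_def)
  qed
qed

end

context lazy_walk_tree
begin

lemma laplacian_odd_ext_near:
  assumes "balanced (D X Y) \<phi>" and near: "v \<in> half_tree X Y"
  shows "laplacian (odd_ext X Y \<phi>) v = profile_laplacian q \<phi> (D v Y)"
proof -
  have "v \<noteq> Y" using near by auto
  have "odd_ext X Y \<phi> w = \<phi> (D v Y + 1)" if "w \<in> children Y v" for w
    using that half_tree_child[OF near that] by (simp add: odd_ext_def children_def)
  then have "(\<Sum>w\<in>N v. odd_ext X Y \<phi> w) = \<phi> (D v Y - 1) + real q * \<phi> (D v Y + 1)"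
    using \<open>v \<noteq> Y\<close> odd_ext_parent[OF assms] by (simp add: sum_neighbors_eq card_children)
  then show ?thesis
    using near by (simp add: laplacian_eq profile_laplacian_def odd_ext_def)
qed

lemma laplacian_odd_ext_equidistant:
  assumes "X \<noteq> Y" and equidistant: "D v X = D v Y"
  shows "laplacian (odd_ext X Y \<phi>) v = 0"
proof -
  have ne: "v \<noteq> X" "v \<noteq> Y" using assms by auto
  let ?x = "parent X v" and ?y = "parent Y v"
  have rest: "odd_ext X Y \<phi> w = 0" if "w \<in> N v - {?x, ?y}" for w
  proof -
    have "w \<in> children X v" "w \<in> children Y v"
      using that neighbors_eq_parent_children ne by blast+
    then show ?thesis using equidistant by (simp add: odd_ext_def children_def)
  qed
  have "(\<Sum>w\<in>N v. odd_ext X Y \<phi> w) = (\<Sum>w\<in>{?x, ?y}. odd_ext X Y \<phi> w)"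
    using ne adj_parent rest by (intro sum.mono_neutral_right) auto
  also have "\<dots> = 0"
  proof (cases "?x = ?y")
    case True
    then show ?thesis
      using dist_parent[OF ne(1)] dist_parent[OF ne(2)] equidistant by (simp add: odd_ext_def)
  next
    case False
    have "?x \<in> insert ?y (children Y v)" "?y \<in> insert ?x (children X v)"
      using ne adj_parent by (simp_all flip: neighbors_eq_parent_children)
    then show ?thesis
      using False dist_parent[OF ne(1)] dist_parent[OF ne(2)] equidistant
      by (simp add: odd_ext_def children_def)
  qed
  finally show ?thesis using equidistant by (simp add: laplacian_eq odd_ext_def)
qed

lemma laplacian_odd_ext:
  assumes "X \<noteq> Y" and balanced: "balanced (D X Y) \<phi>"
  shows "laplacian (odd_ext X Y \<phi>) v = odd_ext X Y (profile_laplacian q \<phi>) v"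
proof -
  consider "v \<in> half_tree X Y" | "D v X = D v Y" | "v \<in> half_tree Y X"
    using linorder_cases by auto
  then show ?thesis
  proof cases
    case 1
    then show ?thesis using laplacian_odd_ext_near[OF balanced 1] by (simp add: odd_ext_def)
  next
    case 2
    then show ?thesis
      using laplacian_odd_ext_equidistant[OF assms(1) 2] by (simp add: odd_ext_def)
  next
    case 3
    have "laplacian (odd_ext X Y \<phi>) v = - laplacian (odd_ext Y X \<phi>) v"
      unfolding laplacian_eq odd_ext_swap[of X Y] sum_negf by simp
    also have "\<dots> = - profile_laplacian q \<phi> (D v X)"
      using laplacian_odd_ext_near[of Y X \<phi> v] balanced 3 by (simp add: dist_commute[of Y X])
    finally show ?thesis using 3 by (simp add: odd_ext_def)
  qed
qed

abbreviation harmonic :: "'v \<Rightarrow> 'v \<Rightarrow> 'v \<Rightarrow> real" where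
  "harmonic X Y \<equiv> odd_ext X Y (harmonic_profile q (D X Y))"

abbreviation correction :: "'v \<Rightarrow> 'v \<Rightarrow> 'v \<Rightarrow> real" where
  "correction X Y \<equiv> odd_ext X Y (decaying_profile q (D X Y))"

abbreviation compensated_potential :: "'v \<Rightarrow> 'v \<Rightarrow> 'v \<Rightarrow> real" where
  "compensated_potential X Y \<equiv> odd_ext X Y (compensated_profile q (D X Y))"

lemma laplacian_harmonic:
  assumes "X \<noteq> Y"
  shows "laplacian (harmonic X Y) v = 0"
proof -
  have "laplacian (harmonic X Y) v = odd_ext X Y (\<lambda>_. 0) v"
    unfolding laplacian_odd_ext[OF assms balanced_harmonic_profile[OF q_pos]]
    using q_pos by (intro odd_ext_cong profile_laplacian_harmonic)
  then show ?thesis by (simp add: odd_ext_def)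
qed

lemma laplacian_compensated_potential:
  assumes "X \<noteq> Y"
  shows "laplacian (compensated_potential X Y) v = (real q - 1) * harmonic X Y v"
proof -
  have "laplacian (compensated_potential X Y) v =
      odd_ext X Y (\<lambda>r. (real q - 1) * harmonic_profile q (D X Y) r) v"
    unfolding laplacian_odd_ext[OF assms balanced_compensated_profile[OF q_pos]]
    using q_pos by (intro odd_ext_cong profile_laplacian_compensated)
  then show ?thesis by (simp add: odd_ext_def)
qed

lemma compensated_potential_eq:
  "compensated_potential X Y v = potential X Y v + correction X Y v"
  by (auto simp: odd_ext_def compensated_profile_def)

lemma walk_mean_compensated_potential:
  assumes "X \<noteq> Y"
  shows "2 * walk_mean X n (compensated_potential X Y) =
    A_SRW \<alpha> (D X Y) q * real n + B_SRW \<alpha> (D X Y) q"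
proof -
  have at_start: "odd_ext X Y \<phi> X = \<phi> (D X Y)" for \<phi>
    using assms by (simp add: odd_ext_def)
  have "walk_mean X n (compensated_potential X Y) = compensated_profile q (D X Y) (D X Y) +
      edge_prob * (real q - 1) * real n * harmonic_profile q (D X Y) (D X Y)"
    using walk_mean_linear_growth laplacian_compensated_potential[OF assms]
      laplacian_harmonic[OF assms] by (simp add: at_start)
  then show ?thesis
    unfolding A_SRW_eq[OF q_pos] B_SRW_eq[OF q_pos] edge_prob_def[symmetric]
    by (simp add: algebra_simps)
qed

lemma wasserstein1_walk_exact:
  assumes "X \<noteq> Y"
  shows "wasserstein1 E (walk X n) (walk Y n) = A_SRW \<alpha> (D X Y) q * real n + B_SRW \<alpha> (D X Y) q
    - (walk_mean X n (correction X Y) + walk_mean Y n (correction Y X))"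
proof -
  have mean: "2 * walk_mean Z n (potential Z Z') =
      A_SRW \<alpha> (D Z Z') q * real n + B_SRW \<alpha> (D Z Z') q - 2 * walk_mean Z n (correction Z Z')"
    if "Z \<noteq> Z'" for Z Z'
  proof -
    have "compensated_potential Z Z' = (\<lambda>v. potential Z Z' v + correction Z Z' v)"
      by (intro ext compensated_potential_eq)
    then have "walk_mean Z n (compensated_potential Z Z') =
        walk_mean Z n (potential Z Z') + walk_mean Z n (correction Z Z')"
      by simp
    then show ?thesis using walk_mean_compensated_potential[OF that, of n] by simp
  qed
  have swap: "potential X Y = (\<lambda>v. - potential Y X v)"
    by (simp add: odd_ext_swap[of X Y] dist_commute[of Y X] fun_eq_iff)
  have "walk_mean Y n (potential X Y) = - walk_mean Y n (potential Y X)"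
    unfolding swap by simp
  then show ?thesis
    using mean[OF assms] mean[OF assms[symmetric]]
    unfolding wasserstein1_walk by (simp add: dist_commute[of Y X])
qed

definition decay_rate :: real where
  "decay_rate = 1 - edge_prob * (sqrt (real q) - 1)\<^sup>2"

lemma decay_rate_nonneg: "0 \<le> decay_rate"
proof -
  have "(sqrt (real q) - 1)\<^sup>2 \<le> real q + 1"
    by (simp add: power2_diff)
  then have "edge_prob * (sqrt (real q) - 1)\<^sup>2 \<le> edge_prob * (real q + 1)"
    using edge_prob_nonneg by (rule mult_left_mono)
  also have "\<dots> \<le> 1" using alpha_nonneg by (simp add: edge_prob_def)
  finally show ?thesis by (simp add: decay_rate_def)
qed

lemma decay_rate_less_1:
  assumes "1 < q" "\<alpha> < 1"
  shows "decay_rate < 1"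
  using assms by (simp add: decay_rate_def edge_prob_def)

lemma laplacian_inverse_sqrt_power:
  "laplacian (\<lambda>w. 1 / sqrt (real q) ^ D w X) v \<le>
    - (sqrt (real q) - 1)\<^sup>2 * (1 / sqrt (real q) ^ D v X)"
proof -
  let ?s = "sqrt (real q)"
  have s: "0 < ?s" "?s * ?s = real q" "1 \<le> real q"
    using q_pos by auto
  have "radial_sum q (\<lambda>r. 1 / ?s ^ r) r \<le> 2 * ?s * (1 / ?s ^ r)" for r
  proof (cases r)
    case 0
    with s show ?thesis by (simp add: radial_sum_def divide_le_eq mult.assoc)
  next
    case (Suc k)
    with s show ?thesis by (simp add: radial_sum_def field_simps)
  qed
  from this[of "D v X"] show ?thesis
    unfolding laplacian_eq sum_neighbors_radial[where \<phi> = "\<lambda>r. 1 / ?s ^ r"]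
    by (simp add: power2_diff algebra_simps)
qed

lemma walk_mean_inverse_sqrt_power:
  "walk_mean X n (\<lambda>w. 1 / sqrt (real q) ^ D w X) \<le> decay_rate ^ n"
  using walk_mean_geometric_decay[OF laplacian_inverse_sqrt_power[of X], of X n] decay_rate_nonneg
  by (simp add: decay_rate_def)

lemma correction_bound:
  assumes "1 < q"
  shows "\<exists>K\<ge>0. \<forall>v. \<bar>correction X Y v\<bar> \<le> K * (1 / sqrt (real q) ^ D v X)"
proof -
  obtain K where K: "\<And>r. \<bar>decaying_profile q (D X Y) r\<bar> \<le> K * (1 / sqrt (real q) ^ r)"
    using decaying_profile_bound[OF assms, of "D X Y"] by auto
  have K_nonneg: "0 \<le> K" using K[of 0] by simp
  have decreasing: "K * (1 / sqrt (real q) ^ r') \<le> K * (1 / sqrt (real q) ^ r)"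
    if "r \<le> r'" for r r'
    using K_nonneg assms that
    by (intro mult_left_mono divide_left_mono power_increasing) auto
  have "\<bar>correction X Y v\<bar> \<le> K * (1 / sqrt (real q) ^ D v X)" for v
    using K[of "D v X"] order_trans[OF K[of "D v Y"] decreasing, of "D v X"] K_nonneg
    by (auto simp: odd_ext_def)
  with K_nonneg show ?thesis by blast
qed

lemma walk_mean_correction_tendsto_0:
  assumes "1 < q" "\<alpha> < 1"
  shows "(\<lambda>n. walk_mean X n (correction X Y)) \<longlonglongrightarrow> 0"
proof -
  obtain K where K: "0 \<le> K" "\<And>v. \<bar>correction X Y v\<bar> \<le> K * (1 / sqrt (real q) ^ D v X)"
    using correction_bound[OF assms(1), of X Y] by auto
  have bound: "norm (walk_mean X n (correction X Y)) \<le> K * decay_rate ^ n" for n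
  proof -
    have "norm (walk_mean X n (correction X Y)) \<le> walk_mean X n (\<lambda>v. \<bar>correction X Y v\<bar>)"
      unfolding real_norm_def by (rule integral_abs_bound)
    also have "\<dots> \<le> walk_mean X n (\<lambda>v. K * (1 / sqrt (real q) ^ D v X))"
      by (intro integral_mono integrable_walk K(2))
    also have "\<dots> = K * walk_mean X n (\<lambda>v. 1 / sqrt (real q) ^ D v X)"
      by (rule integral_mult_right_zero)
    also have "\<dots> \<le> K * decay_rate ^ n"
      using walk_mean_inverse_sqrt_power K(1) by (rule mult_left_mono)
    finally show ?thesis .
  qed
  have "(\<lambda>n. K * decay_rate ^ n) \<longlonglongrightarrow> 0"
    using decay_rate_nonneg decay_rate_less_1[OF assms]
    by (intro tendsto_mult_right_zero LIMSEQ_power_zero) simp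
  with bound show ?thesis
    by (rule Lim_null_comparison[OF always_eventually[OF allI]])
qed

theorem wasserstein1_walk_asymptotics:
  assumes "X \<noteq> Y" "1 < q" "\<alpha> < 1"
  shows "(\<lambda>n. wasserstein1 E (walk X n) (walk Y n) -
    (A_SRW \<alpha> (D X Y) q * real n + B_SRW \<alpha> (D X Y) q)) \<longlonglongrightarrow> 0"
proof -
  have error: "wasserstein1 E (walk X n) (walk Y n) -
      (A_SRW \<alpha> (D X Y) q * real n + B_SRW \<alpha> (D X Y) q) =
      - (walk_mean X n (correction X Y) + walk_mean Y n (correction Y X))" for n
    by (simp add: wasserstein1_walk_exact[OF assms(1)])
  have "(\<lambda>n. - (walk_mean X n (correction X Y) + walk_mean Y n (correction Y X))) \<longlonglongrightarrow>
      - (0 + 0)"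
    using assms(2,3) by (intro tendsto_intros walk_mean_correction_tendsto_0)
  then show ?thesis
    unfolding error by simp
qed

end

theorem theorem7p10:
  fixes E :: "'v \<Rightarrow> 'v \<Rightarrow> bool" and X Y :: 'v and q d :: nat and \<alpha> :: real
  assumes "q \<ge> 2" and "d \<ge> 1" and "0 \<le> \<alpha>" and "\<alpha> < 1"
    and "is_tree E" and "regular_graph (q + 1) E"
    and "graph_dist E X Y = d"
  shows "(\<lambda>n. wasserstein1 E (lazy_walk E \<alpha> X n) (lazy_walk E \<alpha> Y n)
              - (A_SRW \<alpha> d q * real n + B_SRW \<alpha> d q)) \<in> o(\<lambda>n. 1)"
proof -
  interpret lazy_walk_tree E q \<alpha>
    using assms by unfold_locales (auto simp: is_tree_def)
  have "X \<noteq> Y" using assms(2,7) by auto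
  then show ?thesis
    using wasserstein1_walk_asymptotics[of X Y] assms(1,4,7)
    by (intro smalloI_tendsto) auto
qed

end
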